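(* Let $n\ge s$ be positive integers, let $k=2$, and let $(a_1,\dots,a_s)$ and $(b_1,\dots,b_s)$ be two permutations of $\{0,1,\dots,s-1\}$. Then the sequence $f_1,\dots,f_s$ given by $f_i = n(a_i+b_i)$ for $i=1,\dots,s$ is satisfying (with respect to $n$, $s$ and $k=2$).
   Context: Let $[n]=\{1,\dots,n\}$. Two tuples $F,G\in[n]^k$ are disjoint if, for each $i\in\{1,\dots,k\}$, the $i$-th coordinate of $F$ is different from the $i$-th coordinate of $G$. Let $n\ge s$ and $k$ be positive integers. A sequence $f_1,\dots,f_s$ is called satisfying if for every list of subsets $\mathcal F_1,\dots,\mathcal F_s\subseteq [n]^k$ with $|\mathcal F_i|>f_i$ for all $i$, there exist pairwise disjoint tuples $F_1\in\mathcal F_1,\dots,F_s\in\mathcal F_s$ (a rainbow matching). *)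

theory Defs
  imports "HOL-Library.FuncSet"
begin

definition tuples :: "nat \<Rightarrow> nat \<Rightarrow> (nat \<Rightarrow> nat) set" where
  "tuples n k = ({1..k} \<rightarrow>\<^sub>E {1..n})"

definition disjoint_tuples :: "nat \<Rightarrow> (nat \<Rightarrow> nat) \<Rightarrow> (nat \<Rightarrow> nat) \<Rightarrow> bool" where
  "disjoint_tuples k F G \<longleftrightarrow> (\<forall>i\<in>{1..k}. F i \<noteq> G i)"

(* Sequences f_1, ..., f_s and lists of families are functions on nat of which only the values
   at 1, ..., s matter. *)
definition satisfying :: "nat \<Rightarrow> nat \<Rightarrow> nat \<Rightarrow> (nat \<Rightarrow> nat) \<Rightarrow> bool" where
  "satisfying n k s f \<longleftrightarrow>
     (\<forall>\<F> :: nat \<Rightarrow> (nat \<Rightarrow> nat) set.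
        (\<forall>i\<in>{1..s}. \<F> i \<subseteq> tuples n k \<and> card (\<F> i) > f i) \<longrightarrow>
        (\<exists>F :: nat \<Rightarrow> nat \<Rightarrow> nat.
           (\<forall>i\<in>{1..s}. F i \<in> \<F> i) \<and>
           (\<forall>i\<in>{1..s}. \<forall>j\<in>{1..s}. i \<noteq> j \<longrightarrow> disjoint_tuples k (F i) (F j))))"

end

theory Submission
  imports Defs
begin

text \<open>
  A set of more than \<open>n * (a + b)\<close> pairs in an \<open>n \<times> n\<close> grid has more than \<open>b\<close> columns that
  contain more than \<open>a\<close> of its elements each (lemma \<open>many_large_fibres\<close>), since \<open>b\<close> full columns
  and \<open>n\<close> columns with \<open>a\<close> elements each hold at most \<open>n * (a + b)\<close> pairs.

  Sets of which the \<open>i\<close>-th has more than \<open>r i\<close> elements, where the numbers \<open>r i\<close> are distinct, have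
  distinct representatives (lemma \<open>distinct_representatives\<close>), chosen greedily in increasing order
  of \<open>r i\<close>. As \<open>b\<close> is injective, this picks for each family a column with more than \<open>a i\<close> elements
  such that all columns are distinct. As \<open>a\<close> is injective, it then picks an element in each of these
  columns such that all rows are distinct. Together these elements form the rainbow matching.
\<close>

text \<open>
  When \<open>r i\<close> is the largest value so far, the earlier indices have distinct values below \<open>r i\<close>, so
  they number at most \<open>r i\<close> and cannot have used up all of \<open>A i\<close>.
\<close>

lemma distinct_representatives:
  fixes r :: "'i \<Rightarrow> nat" and A :: "'i \<Rightarrow> 'a set"
  assumes "finite I" and "inj_on r I" and "\<And>i. i \<in> I \<Longrightarrow> r i < card (A i)"
  shows "\<exists>g. (\<forall>i\<in>I. g i \<in> A i) \<and> inj_on g I"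
  using assms
proof (induction I rule: finite_ranking_induct[where f = r])
  case empty
  then show ?case by simp
next
  case (insert i J)
  obtain g where g: "\<forall>j\<in>J. g j \<in> A j" "inj_on g J"
    using insert.IH insert.prems by auto
  show ?case
  proof (cases "i \<in> J")
    case True
    then show ?thesis
      using g by (auto simp: insert_absorb)
  next
    case False
    have "r j < r i" if "j \<in> J" for j
      using that False insert.hyps(2) insert.prems(1) by (metis inj_onD insertCI le_neq_implies_less)
    then have "r ` J \<subseteq> {..<r i}" by auto
    then have "card (r ` J) \<le> r i"
      using card_mono[of "{..<r i}"] by simp
    then have "card J \<le> r i"
      using insert.prems(1) by (simp add: card_image inj_on_insert)
    then have "card (g ` J) < card (A i)"
      using card_image_le[OF insert.hyps(1), of g] insert.prems(2)[of i] by simp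
    then have "\<not> A i \<subseteq> g ` J"
      using card_mono[of "g ` J" "A i"] insert.hyps(1) by auto
    then obtain y where y: "y \<in> A i" "y \<notin> g ` J" by blast
    let ?h = "g(i := y)"
    have "inj_on ?h (insert i J)"
      using g(2) y(2) False by (auto simp: inj_on_def)
    moreover have "\<forall>j\<in>insert i J. ?h j \<in> A j"
      using g(1) y(1) by auto
    ultimately show ?thesis by blast
  qed
qed

lemma many_large_fibres:
  fixes p :: "'a \<Rightarrow> 'b" and n a b :: nat
  assumes "finite V" and "card V \<le> n" and "p ` S \<subseteq> V"
    and fibre_le: "\<And>v. v \<in> V \<Longrightarrow> card {x \<in> S. p x = v} \<le> n"
    and large: "n * (a + b) < card S"
  shows "b < card {v \<in> V. a < card {x \<in> S. p x = v}}"
proof (rule ccontr)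
  let ?c = "\<lambda>v. card {x \<in> S. p x = v}"
  let ?D = "{v \<in> V. a < ?c v}"
  assume "\<not> b < card ?D"
  then have few: "card ?D \<le> b" by simp
  have "S = (\<Union>v\<in>V. {x \<in> S. p x = v})"
    using assms(3) by auto
  then have "card S \<le> (\<Sum>v\<in>V. ?c v)"
    using card_UN_le[OF assms(1), of "\<lambda>v. {x \<in> S. p x = v}"] by simp
  also have "\<dots> \<le> (\<Sum>v\<in>V. a + (if v \<in> ?D then n else 0))"
    using fibre_le by (intro sum_mono) (auto simp: trans_le_add2)
  also have "\<dots> = card V * a + card ?D * n"
    using assms(1) by (simp add: sum.distrib sum.If_cases Int_def)
  also have "\<dots> \<le> n * a + b * n"
    using assms(2) few by (intro add_mono mult_right_mono) auto
  finally show False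
    using large by (simp add: algebra_simps)
qed

lemma tuples_coordinate:
  assumes "G \<in> tuples n k" and "i \<in> {1..k}"
  shows "G i \<in> {1..n}"
  using assms unfolding tuples_def by (rule PiE_mem)

lemma inj_on_first_coordinate:
  "inj_on (\<lambda>G. G 1) {G \<in> tuples n 2. G 2 = v}"
proof (rule inj_onI)
  fix G H
  assume G: "G \<in> {G \<in> tuples n 2. G 2 = v}" and H: "H \<in> {G \<in> tuples n 2. G 2 = v}"
    and eq: "G 1 = H 1"
  have "G i = H i" if "i \<in> {1..2}" for i
  proof -
    have "i = 1 \<or> i = 2" using that by auto
    then show ?thesis using G H eq by auto
  qed
  then show "G = H"
    using G H PiE_ext[of G "{1..2}" "\<lambda>_. {1..n}" H] unfolding tuples_def by simp
qed

theorem theorem1p6: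
  fixes n s :: nat and a b :: "nat \<Rightarrow> nat"
  assumes "s \<ge> 1" and "n \<ge> s"
    and "bij_betw a {1..s} {0..<s}"
    and "bij_betw b {1..s} {0..<s}"
  shows "satisfying n 2 s (\<lambda>i. n * (a i + b i))"
  unfolding satisfying_def
proof (intro allI impI)
  fix \<F> :: "nat \<Rightarrow> (nat \<Rightarrow> nat) set"
  assume \<F>: "\<forall>i\<in>{1..s}. \<F> i \<subseteq> tuples n 2 \<and> n * (a i + b i) < card (\<F> i)"
  have inj_a: "inj_on a {1..s}" and inj_b: "inj_on b {1..s}"
    using assms(3,4) by (auto simp: bij_betw_def)
  define rows where "rows i v = (\<lambda>G. G 1) ` {G \<in> \<F> i. G 2 = v}" for i v
  have card_rows: "card (rows i v) = card {G \<in> \<F> i. G 2 = v}" if "i \<in> {1..s}" for i v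
    unfolding rows_def using \<F> that
    by (intro card_image inj_on_subset[OF inj_on_first_coordinate[of n v]]) auto
  have rows_le: "card (rows i v) \<le> n" if "i \<in> {1..s}" for i v
  proof -
    have "rows i v \<subseteq> {1..n}"
      using \<F> that tuples_coordinate[of _ n 2 1] unfolding rows_def by fastforce
    then show ?thesis
      using card_mono[of "{1..n}"] by simp
  qed
  have "b i < card {v \<in> {1..n}. a i < card (rows i v)}" if i: "i \<in> {1..s}" for i
    unfolding card_rows[OF i]
  proof (rule many_large_fibres)
    show "(\<lambda>G. G 2) ` \<F> i \<subseteq> {1..n}"
      using \<F> i tuples_coordinate[of _ n 2 2] by fastforce
    show "card {G \<in> \<F> i. G 2 = v} \<le> n" for v
      using rows_le[OF i] card_rows[OF i] by simp
  qed (use \<F> i in auto)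
  then obtain col where col: "\<forall>i\<in>{1..s}. a i < card (rows i (col i))" "inj_on col {1..s}"
    using distinct_representatives[OF _ inj_b, of "\<lambda>i. {v \<in> {1..n}. a i < card (rows i v)}"]
    by auto
  obtain row where row: "\<forall>i\<in>{1..s}. row i \<in> rows i (col i)" "inj_on row {1..s}"
    using distinct_representatives[OF _ inj_a, of "\<lambda>i. rows i (col i)"] col(1) by auto
  have "\<forall>i\<in>{1..s}. \<exists>G. G \<in> \<F> i \<and> G 1 = row i \<and> G 2 = col i"
    using row(1) unfolding rows_def by fastforce
  then obtain F where F: "\<forall>i\<in>{1..s}. F i \<in> \<F> i \<and> F i 1 = row i \<and> F i 2 = col i"
    by metis
  have "disjoint_tuples 2 (F i) (F j)" if "i \<in> {1..s}" "j \<in> {1..s}" "i \<noteq> j" for i j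
  proof -
    have ne: "row i \<noteq> row j" "col i \<noteq> col j"
      using that row(2) col(2) by (meson inj_onD)+
    have "F i m \<noteq> F j m" if m: "m \<in> {1..2}" for m
    proof -
      have "m = 1 \<or> m = 2" using m by auto
      then show ?thesis
        using ne F \<open>i \<in> {1..s}\<close> \<open>j \<in> {1..s}\<close> by metis
    qed
    then show ?thesis
      unfolding disjoint_tuples_def by blast
  qed
  then show "\<exists>F. (\<forall>i\<in>{1..s}. F i \<in> \<F> i) \<and>
      (\<forall>i\<in>{1..s}. \<forall>j\<in>{1..s}. i \<noteq> j \<longrightarrow> disjoint_tuples 2 (F i) (F j))"
    using F by blast
qed

end
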